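(* Let $A$ be a real $m\times n$ matrix and $S$ an $n\times n$ switching-cost matrix. The minimax value in static strategies $c\mapsto\tilde v(c)$, $c\in[0,\infty)$, is a continuous, increasing (in the weak sense, i.e. non-decreasing), concave and semi-algebraic function.
   Context: A switching-cost matrix is an $n\times n$ matrix $S=(s_{kj})$ with $s_{kj}\ge 0$, $s_{jj}=0$ for all $k,j$, normalized so that its smallest nonzero entry is $1$. In the repeated zero-sum game with switching costs $(A,S,c)$, $c\ge0$, Player 2 (column player, minimizer) pays Player 1 (row player, maximizer) at each stage $t$ the amount $a_{i(t)j(t)}+c\,s_{j(t-1)j(t)}$, and payoffs are long-run averages. A static strategy plays the same mixed action at every stage, regardless of history. If Player 1 uses the static strategy $x\in\Delta(\{1,\dots,m\})$ and Player 2 the static strategy $y\in\Delta(\{1,\dots,n\})$, the payoff is $g(c)(x,y)=x^TAy+c\,y^TSy$, and the minimax value in static strategies is $$\tilde v(c)=\min_{y\in\Delta(\{1,\dots,n\})}\ \max_{x\in\Delta(\{1,\dots,m\})} g(c)(x,y).$$ Here $\Delta(X)$ is the set of probability distributions on the finite set $X$. *)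

theory Defs
  imports "HOL-Analysis.Analysis"
begin

definition prob_simplex :: "(real ^ 'k) set" where
  "prob_simplex = {x. (\<forall>i. 0 \<le> x $ i) \<and> (\<Sum>i\<in>UNIV. x $ i) = 1}"

(* The normalization constrains only matrices that have a nonzero entry, so the
   zero matrix (the only possibility when CARD('n) = 1) is admitted. *)
definition switching_cost_matrix :: "real ^ 'n ^ 'n \<Rightarrow> bool" where
  "switching_cost_matrix S \<longleftrightarrow>
     (\<forall>k j. 0 \<le> S $ k $ j) \<and> (\<forall>j. S $ j $ j = 0) \<and>
     (S \<noteq> 0 \<longrightarrow> Min {S $ k $ j | k j. S $ k $ j \<noteq> 0} = 1)"

definition static_payoff ::
  "real ^ 'n ^ 'm \<Rightarrow> real ^ 'n ^ 'n \<Rightarrow> real \<Rightarrow> real ^ 'm \<Rightarrow> real ^ 'n \<Rightarrow> real" where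
  "static_payoff A S c x y = x \<bullet> (A *v y) + c * (y \<bullet> (S *v y))"

(* The infimum and suprema are attained: see static_value_attained below. *)
definition static_value :: "real ^ 'n ^ 'm \<Rightarrow> real ^ 'n ^ 'n \<Rightarrow> real \<Rightarrow> real" where
  "static_value A S c =
     (INF y\<in>prob_simplex. SUP x\<in>prob_simplex. static_payoff A S c x y)"

definition basic_semialgebraic :: "'a::euclidean_space set \<Rightarrow> bool" where
  "basic_semialgebraic B \<longleftrightarrow>
     (\<exists>P Q. finite P \<and> finite Q \<and> (\<forall>p\<in>P \<union> Q. real_polynomial_function p) \<and>
            B = {x. (\<forall>p\<in>P. p x = 0) \<and> (\<forall>q\<in>Q. q x > 0)})"

definition semialgebraic :: "'a::euclidean_space set \<Rightarrow> bool" where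
  "semialgebraic X \<longleftrightarrow> (\<exists>F. finite F \<and> (\<forall>B\<in>F. basic_semialgebraic B) \<and> X = \<Union>F)"

definition semialgebraic_on ::
  "'a::euclidean_space set \<Rightarrow> ('a \<Rightarrow> 'b::euclidean_space) \<Rightarrow> bool" where
  "semialgebraic_on D f \<longleftrightarrow> semialgebraic ((\<lambda>x. (x, f x)) ` D)"

lemma compact_prob_simplex: "compact (prob_simplex :: (real ^ 'k) set)"
proof -
  have "closed {x :: real ^ 'k. \<forall>i. 0 \<le> x $ i}"
    by (intro closed_Collect_all closed_Collect_le continuous_intros)
  moreover have "closed {x :: real ^ 'k. (\<Sum>i\<in>UNIV. x $ i) = 1}"
    by (intro closed_Collect_eq continuous_intros)
  ultimately have "closed (prob_simplex :: (real ^ 'k) set)"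
    unfolding prob_simplex_def by (rule closed_Collect_conj)
  moreover have "norm x \<le> 1" if "x \<in> prob_simplex" for x :: "real ^ 'k"
    using norm_le_l1_cart[of x] that by (simp add: prob_simplex_def)
  ultimately show ?thesis
    by (auto simp: compact_eq_bounded_closed bounded_iff)
qed

lemma prob_simplex_nonempty: "(prob_simplex :: (real ^ 'k) set) \<noteq> {}"
proof -
  have "axis undefined 1 \<in> (prob_simplex :: (real ^ 'k) set)"
    by (simp add: prob_simplex_def axis_def)
  then show ?thesis by blast
qed

lemma static_payoff_max_attained:
  fixes A :: "real ^ 'n ^ 'm"
  shows "\<exists>x\<in>prob_simplex. (\<forall>x'\<in>prob_simplex. static_payoff A S c x' y \<le> static_payoff A S c x y) \<and>
           (SUP x\<in>prob_simplex. static_payoff A S c x y) = static_payoff A S c x y"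
proof -
  have "continuous_on prob_simplex (\<lambda>x. static_payoff A S c x y)"
    unfolding static_payoff_def
    by (intro continuous_on_add continuous_on_const continuous_on_inner continuous_on_id)
  from continuous_attains_sup[OF compact_prob_simplex prob_simplex_nonempty this]
  obtain x where x: "x \<in> prob_simplex"
    "\<forall>x'\<in>prob_simplex. static_payoff A S c x' y \<le> static_payoff A S c x y" by blast
  then have "(SUP x\<in>prob_simplex. static_payoff A S c x y) = static_payoff A S c x y"
    by (intro cSup_eq_maximum) auto
  with x show ?thesis by blast
qed

lemma static_value_attained:
  fixes A :: "real ^ 'n ^ 'm" and S :: "real ^ 'n ^ 'n"
  defines "M \<equiv> \<lambda>c y. SUP x\<in>prob_simplex. static_payoff A S c x y"
  shows "\<exists>y\<in>prob_simplex. (\<forall>y'\<in>prob_simplex. M c y \<le> M c y') \<and> static_value A S c = M c y"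
proof -
  let ?f = "\<lambda>y. SUP x\<in>prob_simplex. x \<bullet> (A *v y)"
  have ex: "\<exists>x\<in>prob_simplex. (\<forall>x'\<in>prob_simplex. x' \<bullet> (A *v y) \<le> x \<bullet> (A *v y)) \<and>
              ?f y = x \<bullet> (A *v y)" for y
    using static_payoff_max_attained[of A S 0 y] by (simp add: static_payoff_def)
  have M_eq: "M c y = ?f y + c * (y \<bullet> (S *v y))" for c y
  proof -
    obtain x where "x \<in> prob_simplex"
      "\<forall>x'\<in>prob_simplex. x' \<bullet> (A *v y) \<le> x \<bullet> (A *v y)" "?f y = x \<bullet> (A *v y)"
      using ex by blast
    then show ?thesis unfolding M_def static_payoff_def
      by (intro cSup_eq_maximum) auto
  qed
  have lip: "?f y - ?f z \<le> onorm ((*v) A) * norm (y - z)" for y z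
  proof -
    obtain x where x: "x \<in> prob_simplex" "?f y = x \<bullet> (A *v y)" using ex by blast
    obtain w where w: "\<forall>x'\<in>prob_simplex. x' \<bullet> (A *v z) \<le> w \<bullet> (A *v z)"
      "?f z = w \<bullet> (A *v z)" using ex by blast
    have "?f y - ?f z \<le> x \<bullet> (A *v y) - x \<bullet> (A *v z)"
      using x w by simp
    also have "\<dots> = x \<bullet> (A *v (y - z))"
      by (simp add: matrix_vector_mult_diff_distrib inner_diff_right)
    also have "\<dots> \<le> norm x * norm (A *v (y - z))" by (rule norm_cauchy_schwarz)
    also have "\<dots> \<le> 1 * norm (A *v (y - z))"
      using norm_le_l1_cart[of x] x(1) by (intro mult_right_mono) (auto simp: prob_simplex_def)
    also have "\<dots> \<le> onorm ((*v) A) * norm (y - z)"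
      using onorm[of "(*v) A"] by simp
    finally show ?thesis .
  qed
  have "(onorm ((*v) A))-lipschitz_on UNIV ?f"
  proof (rule lipschitz_onI)
    show "dist (?f y) (?f z) \<le> onorm ((*v) A) * dist y z" for y z
      using lip[of y z] lip[of z y] by (simp add: dist_norm norm_minus_commute abs_le_iff)
    show "0 \<le> onorm ((*v) A)" by (simp add: onorm_pos_le)
  qed
  then have "continuous_on prob_simplex ?f"
    using lipschitz_on_continuous_on continuous_on_subset by blast
  then have "continuous_on prob_simplex (M c)"
    unfolding M_eq[abs_def]
    by (intro continuous_on_add continuous_on_mult continuous_on_const continuous_on_inner
        continuous_on_id bounded_linear.continuous_on[OF matrix_vector_mul_bounded_linear])
  from continuous_attains_inf[OF compact_prob_simplex prob_simplex_nonempty this]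
  obtain y where y: "y \<in> prob_simplex" "\<forall>y'\<in>prob_simplex. M c y \<le> M c y'" by blast
  then have "(INF y\<in>prob_simplex. M c y) = M c y"
    by (intro cInf_eq_minimum) auto
  with y show ?thesis by (auto simp: static_value_def M_def)
qed

end

theory Submission imports Defs begin

text \<open>
  A linear function on the simplex is maximal at a vertex, so against \<open>y\<close> the best static reply
  earns \<open>row_max A y + c * (y \<bullet> (S *v y))\<close>, and the static value is the minimum of this expression
  over \<open>y\<close>. For fixed \<open>y\<close> it is affine in \<open>c\<close>, with slope in a bounded interval of nonnegative
  numbers; an infimum of such functions is monotone, concave and Lipschitz.

  Semi-algebraicity needs no quantifier elimination, because the minimum is a quadratic program
  whose parameter only scales the quadratic part. Sort the \<open>c > 0\<close> into finitely many classes,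
  according to the zero coordinates and the best rows of a chosen minimizer \<open>y(c)\<close>. Within a class,
  \<open>row_max A\<close> agrees at the minimizers with one linear form \<open>a\<close>, and optimality in the directions
  \<open>d\<close> that preserve the class reads
  \<open>a d / c + y(c) \<bullet> (S *v d) + d \<bullet> (S *v y(c)) = 0\<close> (\<open>optimal_first_order\<close>). This condition is affine
  in \<open>(1/c, y)\<close>. Hence two minimizers of the class determine critical points \<open>u + (1/c) w\<close> for every
  \<open>c\<close>, and critical points for the same \<open>c\<close> have equal values (\<open>critical_values_equal\<close>), whether or
  not the quadratic form is degenerate. So on each class the value is
  \<open>\<alpha> c + \<beta> + \<gamma> / c\<close> (\<open>static_value_rational_on_face\<close>).

  A continuous function that at each point follows one of finitely many rational branches can change
  branch only where two different branches meet or a denominator vanishes, that is, at finitely many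
  points. Its graph is thus a finite union of points and of arcs of algebraic curves over open
  intervals (\<open>semialgebraic_on_if_rational_branches\<close>).
\<close>

section \<open>Continuous functions with finitely many rational branches\<close>

lemma real_polynomial_function_poly_comp:
  assumes "real_polynomial_function g"
  shows "real_polynomial_function (\<lambda>x. poly p (g x))"
  by (induction p) (use assms in \<open>auto intro!: real_polynomial_function.intros(2-)\<close>)

lemma real_polynomial_function_fst: "real_polynomial_function (fst :: real \<times> real \<Rightarrow> real)"
  and real_polynomial_function_snd: "real_polynomial_function (snd :: real \<times> real \<Rightarrow> real)"
  by (auto intro!: real_polynomial_function.intros(1) bounded_linear_fst bounded_linear_snd)

lemma basic_semialgebraic_singleton: "basic_semialgebraic {(c :: real, w :: real)}"
  unfolding basic_semialgebraic_def
proof (intro exI conjI)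
  show "finite {\<lambda>x :: real \<times> real. fst x - c, \<lambda>x. snd x - w}" by simp
  show "\<forall>p\<in>{\<lambda>x :: real \<times> real. fst x - c, \<lambda>x. snd x - w} \<union> {}. real_polynomial_function p"
    by (auto intro!: real_polynomial_function_diff real_polynomial_function.intros(2)
        real_polynomial_function_fst real_polynomial_function_snd)
  show "{(c, w)} = {x. (\<forall>p\<in>{\<lambda>x. fst x - c, \<lambda>x. snd x - w}. p x = 0) \<and> (\<forall>q\<in>{}. q x > 0)}"
    by (auto simp: prod_eq_iff)
qed simp

text \<open>The arc of the curve \<open>q(c) w = p(c)\<close> over the open interval (possibly empty or unbounded) that
  lies to the right of \<open>L\<close> and to the left of \<open>H\<close>. Naming the interval by the breakpoints on either
  side treats bounded and unbounded intervals alike.\<close>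

definition rational_branch ::
  "real set \<Rightarrow> real set \<Rightarrow> real poly \<Rightarrow> real poly \<Rightarrow> (real \<times> real) set" where
  "rational_branch L H p q =
     {x. (\<forall>b\<in>L. b < fst x) \<and> (\<forall>b\<in>H. fst x < b) \<and> poly q (fst x) * snd x = poly p (fst x)}"

lemma basic_semialgebraic_rational_branch:
  assumes "finite L" "finite H"
  shows "basic_semialgebraic (rational_branch L H p q)"
  unfolding basic_semialgebraic_def
proof (intro exI conjI)
  let ?P = "{\<lambda>x :: real \<times> real. poly q (fst x) * snd x - poly p (fst x)}"
  let ?Q = "(\<lambda>b (x :: real \<times> real). fst x - b) ` L \<union> (\<lambda>b x. b - fst x) ` H"
  show "finite ?P" "finite ?Q" using assms by auto
  show "\<forall>p\<in>?P \<union> ?Q. real_polynomial_function p"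
    by (auto intro!: real_polynomial_function_diff real_polynomial_function.intros(2)
        real_polynomial_function.intros(4) real_polynomial_function_poly_comp
        real_polynomial_function_fst real_polynomial_function_snd)
  show "rational_branch L H p q = {x. (\<forall>p\<in>?P. p x = 0) \<and> (\<forall>q\<in>?Q. q x > 0)}"
    by (auto simp: rational_branch_def ball_Un)
qed

text \<open>Each set where \<open>f\<close> follows a given branch is closed by continuity. Since different branches
  do not meet over \<open>U\<close>, the complement of one such set is a finite union of others, so it is closed
  too; connectedness of \<open>U\<close> then leaves a single branch. The same rational function may occur in \<open>R\<close>
  as several fractions, so branches are compared by cross-multiplication.\<close>

lemma rational_branches_unique_on_connected:
  fixes f :: "real \<Rightarrow> real" and R :: "(real poly \<times> real poly) set"
  assumes conn: "connected U" and cont: "continuous_on U f" and fin: "finite R"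
    and branch: "\<And>c. c \<in> U \<Longrightarrow> \<exists>(p, q)\<in>R. poly q c * f c = poly p c"
    and nonzero: "\<And>p q c. (p, q) \<in> R \<Longrightarrow> c \<in> U \<Longrightarrow> poly q c \<noteq> 0"
    and separated: "\<And>p q p' q' c. (p, q) \<in> R \<Longrightarrow> (p', q') \<in> R \<Longrightarrow> c \<in> U \<Longrightarrow>
                      poly (q * p') c = poly (q' * p) c \<Longrightarrow> q * p' = q' * p"
    and pq: "(p, q) \<in> R" and c: "c \<in> U" "poly q c * f c = poly p c" and c': "c' \<in> U"
  shows "poly q c' * f c' = poly p c'"
proof -
  define E where "E = (\<lambda>(p, q). {c \<in> U. poly q c * f c - poly p c = 0})"
  define R' where "R' = {(p', q') \<in> R. q * p' \<noteq> q' * p}"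
  have closed: "closedin (top_of_set U) (E r)" for r
    unfolding E_def split_def
    by (intro continuous_closedin_preimage_constant continuous_intros cont)
  have "U - E (p, q) = \<Union>(E ` R')"
  proof (intro equalityI subsetI)
    fix x assume x: "x \<in> U - E (p, q)"
    then obtain p' q' where r: "(p', q') \<in> R" "poly q' x * f x = poly p' x"
      using branch by blast
    have "q * p' \<noteq> q' * p"
    proof
      assume "q * p' = q' * p"
      then have "poly (q * p') x = poly (q' * p) x" by simp
      then have "poly q' x * (poly q x * f x) = poly q' x * poly p x"
        using r(2) by (simp add: algebra_simps flip: r(2))
      then show False using x nonzero[OF r(1), of x] by (auto simp: E_def)
    qed
    then show "x \<in> \<Union>(E ` R')" using x r by (force simp: E_def R'_def)
  next
    fix x assume "x \<in> \<Union>(E ` R')"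
    then obtain p' q' where r: "(p', q') \<in> R" "q * p' \<noteq> q' * p"
      "x \<in> U" "poly q' x * f x = poly p' x"
      by (auto simp: E_def R'_def)
    have "poly q x * f x \<noteq> poly p x"
    proof
      assume "poly q x * f x = poly p x"
      then have "poly (q * p') x = poly (q' * p) x" 
        using r(4) by (simp flip: r(4))
      then show False using separated[OF pq r(1,3)] r(2) by simp
    qed
    then show "x \<in> U - E (p, q)" using r by (auto simp: E_def)
  qed
  moreover have "closedin (top_of_set U) (\<Union>(E ` R'))"
    using fin closed by (intro closedin_Union) (auto simp: R'_def intro: finite_subset)
  ultimately have "openin (top_of_set U) (E (p, q))"
    using closed[of "(p, q)"] by (simp add: openin_closedin_eq E_def Collect_restrict)
  then have "E (p, q) = {} \<or> E (p, q) = U"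
    using conn closed connected_clopen by blast
  then show ?thesis using c c' by (auto simp: E_def)
qed

text \<open>The breakpoints \<open>K\<close> are the left end \<open>a\<close>, the zeros of the denominators and the points where
  two different branches meet. Between consecutive breakpoints \<open>f\<close> stays on one branch.\<close>

lemma semialgebraic_on_if_rational_branches:
  fixes f :: "real \<Rightarrow> real" and R :: "(real poly \<times> real poly) set"
  assumes cont: "continuous_on {a..} f" and fin: "finite R"
    and nonzero: "\<And>p q. (p, q) \<in> R \<Longrightarrow> q \<noteq> 0"
    and branch: "\<And>c. c > a \<Longrightarrow> \<exists>(p, q)\<in>R. poly q c * f c = poly p c"
  shows "semialgebraic_on {a..} f"
proof -
  define G where "G = (\<lambda>c. (c, f c)) ` {a..}"
  define D where "D = (snd ` R \<union> (\<lambda>((p, q), (p', q')). q * p' - q' * p) ` (R \<times> R)) - {0}"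
  define K where "K = insert a (\<Union>d\<in>D. {c. poly d c = 0})"
  \<comment> \<open>Keeping only the arcs inside the graph leaves one inclusion to prove: the kept arcs and the
     points over the breakpoints cover the graph.\<close>
  define F where "F = {B. (\<exists>L\<in>Pow K. \<exists>(p, q)\<in>R. B = rational_branch L (K - L) p q) \<and> B \<subseteq> G} \<union>
                      (\<lambda>c. {(c, f c)}) ` (K \<inter> {a..})"
  have "finite D" using fin by (simp add: D_def)
  then have finK: "finite K" by (auto simp: K_def D_def intro!: poly_roots_finite)
  have "finite ((\<lambda>(L, p, q). rational_branch L (K - L) p q) ` (Pow K \<times> R))"
    using finK fin by simp
  then have "finite {B. (\<exists>L\<in>Pow K. \<exists>(p, q)\<in>R. B = rational_branch L (K - L) p q) \<and> B \<subseteq> G}"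
    by (rule rev_finite_subset) force
  then have "finite F" using finK by (simp add: F_def)
  moreover have "\<forall>B\<in>F. basic_semialgebraic B"
    using finK by (auto simp: F_def basic_semialgebraic_singleton
        intro!: basic_semialgebraic_rational_branch intro: finite_subset)
  moreover have "G = \<Union>F"
  proof
    show "\<Union>F \<subseteq> G" by (auto simp: F_def G_def)
    show "G \<subseteq> \<Union>F"
    proof
      fix x assume "x \<in> G"
      then obtain c where c: "c \<ge> a" "x = (c, f c)" by (auto simp: G_def)
      show "x \<in> \<Union>F"
      proof (cases "c \<in> K")
        case True
        then show ?thesis using c by (auto simp: F_def)
      next
        case False
        define L where "L = {b \<in> K. b < c}"
        define U where "U = {u. (\<forall>b\<in>L. b < u) \<and> (\<forall>b\<in>K - L. u < b)}"
        have ca: "c > a" using c False by (cases "c = a") (auto simp: K_def)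
        then have "a \<in> L" by (simp add: L_def K_def)
        then have Ua: "U \<subseteq> {a<..}" by (auto simp: U_def)
        have cU: "c \<in> U" using False by (auto simp: U_def L_def not_less le_less)
        have UK: "u \<notin> K" if "u \<in> U" for u
          using that by (cases "u \<in> L") (auto simp: U_def)
        have Dnz: "poly d u \<noteq> 0" if "d \<in> D" "u \<in> U" for d u
          using UK[OF that(2)] that(1) by (auto simp: K_def)
        obtain p q where pq: "(p, q) \<in> R" "poly q c * f c = poly p c"
          using branch[OF ca] by blast
        have q0: "poly q' u \<noteq> 0" if "(p', q') \<in> R" "u \<in> U" for p' q' u
          using that nonzero[OF that(1)] by (intro Dnz) (force simp: D_def)+
        have sep: "s * p' = q' * r"
          if "(r, s) \<in> R" "(p', q') \<in> R" "u \<in> U" "poly (s * p') u = poly (q' * r) u"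
          for r s p' q' u
        proof (rule ccontr)
          assume "s * p' \<noteq> q' * r"
          then have "s * p' - q' * r \<in> D" using that(1,2) by (force simp: D_def)
          from Dnz[OF this that(3)] show False using that(4) by simp
        qed
        have "connected U"
          unfolding connected_iff_interval U_def
          by (blast intro: less_le_trans le_less_trans)
        moreover have "continuous_on U f"
          using Ua by (intro continuous_on_subset[OF cont]) auto
        ultimately have all: "poly q u * f u = poly p u" if "u \<in> U" for u
        proof (rule rational_branches_unique_on_connected[where U = U and f = f and R = R, OF _ _ fin _ q0 sep pq(1) cU pq(2) that])
          show "\<exists>(p, q)\<in>R. poly q b * f b = poly p b" if "b \<in> U" for b
            using branch Ua that by blast
        qed
        have "rational_branch L (K - L) p q \<subseteq> G"
        proof
          fix z assume z: "z \<in> rational_branch L (K - L) p q"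
          then have zU: "fst z \<in> U" by (auto simp: rational_branch_def U_def)
          \<comment> \<open>The denominator has no zero over \<open>U\<close>, so the arc contains nothing but the graph.\<close>
          have "poly q (fst z) * snd z = poly q (fst z) * f (fst z)"
            using z all[OF zU] by (simp add: rational_branch_def)
          then have "snd z = f (fst z)" using q0[OF pq(1) zU] by simp
          then show "z \<in> G" using zU Ua by (force simp: G_def prod_eq_iff image_iff)
        qed
        moreover have "x \<in> rational_branch L (K - L) p q"
          using cU pq(2) c(2) by (auto simp: rational_branch_def U_def)
        ultimately show ?thesis
          using pq(1) by (intro UnionI[of "rational_branch L (K - L) p q"])
            (auto simp: F_def L_def)
      qed
    qed
  qed
  ultimately show ?thesis
    unfolding semialgebraic_on_def semialgebraic_def G_def by blast
qed

section \<open>The static value as a parametric quadratic minimum\<close>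

definition row_max :: "real ^ 'n ^ 'm \<Rightarrow> real ^ 'n \<Rightarrow> real" where
  "row_max A y = Max (range (\<lambda>i. (A *v y) $ i))"

definition best_rows :: "real ^ 'n ^ 'm \<Rightarrow> real ^ 'n \<Rightarrow> 'm set" where
  "best_rows A y = {i. (A *v y) $ i = row_max A y}"

text \<open>The maximal payoff of Player 1 against \<open>y\<close>; see \<open>SUP_static_payoff\<close>.\<close>

definition guarantee :: "real ^ 'n ^ 'm \<Rightarrow> real ^ 'n ^ 'n \<Rightarrow> real \<Rightarrow> real ^ 'n \<Rightarrow> real" where
  "guarantee A S c y = row_max A y + c * (y \<bullet> (S *v y))"

definition optimal :: "real ^ 'n ^ 'm \<Rightarrow> real ^ 'n ^ 'n \<Rightarrow> real \<Rightarrow> real ^ 'n \<Rightarrow> bool" where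
  "optimal A S c y \<longleftrightarrow> y \<in> prob_simplex \<and> (\<forall>z\<in>prob_simplex. guarantee A S c y \<le> guarantee A S c z)"

lemma row_le_row_max: "(A *v y) $ i \<le> row_max A y"
  by (simp add: row_max_def)

lemma best_rows_nonempty: "best_rows A y \<noteq> {}"
proof -
  have "row_max A y \<in> range (\<lambda>i. (A *v y) $ i)"
    unfolding row_max_def by (rule Max_in) auto
  then show ?thesis by (force simp: best_rows_def)
qed

lemma row_max_eqI:
  assumes "\<And>i. (A *v y) $ i \<le> b" "(A *v y) $ k = b"
  shows "row_max A y = b"
  unfolding row_max_def using assms by (intro Max_eqI) auto

text \<open>The payoff is an average of the rows' payoffs, so a pure best row is a best reply.\<close>

lemma SUP_static_payoff:
  "(SUP x\<in>prob_simplex. static_payoff A S c x y) = guarantee A S c y"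
proof (rule cSup_eq_maximum)
  obtain k where "k \<in> best_rows A y" using best_rows_nonempty by blast
  then have "static_payoff A S c (axis k 1) y = guarantee A S c y"
    by (simp add: static_payoff_def guarantee_def best_rows_def inner_axis')
  moreover have "axis k 1 \<in> prob_simplex" by (simp add: prob_simplex_def axis_def)
  ultimately show "guarantee A S c y \<in> (\<lambda>x. static_payoff A S c x y) ` prob_simplex"
    by (metis image_eqI)
next
  fix r assume "r \<in> (\<lambda>x. static_payoff A S c x y) ` prob_simplex"
  then obtain x where x: "x \<in> prob_simplex" "r = static_payoff A S c x y" by blast
  have "x \<bullet> (A *v y) = (\<Sum>i\<in>UNIV. x $ i * (A *v y) $ i)" by (simp add: inner_vec_def)
  also have "\<dots> \<le> (\<Sum>i\<in>UNIV. x $ i * row_max A y)"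
    using x(1) by (intro sum_mono mult_left_mono row_le_row_max) (auto simp: prob_simplex_def)
  also have "\<dots> = row_max A y"
    using x(1) by (simp add: prob_simplex_def flip: sum_distrib_right)
  finally show "r \<le> guarantee A S c y" by (simp add: x(2) static_payoff_def guarantee_def)
qed

lemma optimal_exists: "\<exists>y. optimal A S c y"
  using static_value_attained[of A S c] unfolding SUP_static_payoff optimal_def by blast

lemma static_value_optimal: "optimal A S c y \<Longrightarrow> static_value A S c = guarantee A S c y"
  unfolding static_value_def SUP_static_payoff optimal_def by (intro cInf_eq_minimum) auto

lemma static_value_le: "y \<in> prob_simplex \<Longrightarrow> static_value A S c \<le> guarantee A S c y"
  using optimal_exists[of A S c] static_value_optimal[of A S c] by (auto simp: optimal_def)

section \<open>Order and continuity properties\<close>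

lemma switching_cost_nonneg:
  assumes "switching_cost_matrix S" "y \<in> prob_simplex"
  shows "0 \<le> y \<bullet> (S *v y)"
  using assms unfolding inner_vec_def matrix_vector_mult_def
  by (auto simp: switching_cost_matrix_def prob_simplex_def intro!: sum_nonneg mult_nonneg_nonneg)

text \<open>In the following three proofs, a minimizer for one parameter serves as a competitor for
  another; its guarantee is an affine function of the parameter.\<close>

lemma mono_on_static_value:
  assumes "switching_cost_matrix S"
  shows "mono_on {0..} (static_value A S)"
proof (rule mono_onI)
  fix c c' :: real assume "c \<le> c'"
  obtain y where y: "optimal A S c' y" using optimal_exists by blast
  then have yP: "y \<in> prob_simplex" by (simp add: optimal_def)
  have "static_value A S c \<le> guarantee A S c y" using yP by (rule static_value_le)
  also have "\<dots> \<le> guarantee A S c' y"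
    using \<open>c \<le> c'\<close> switching_cost_nonneg[OF assms yP]
    by (simp add: guarantee_def mult_right_mono)
  also have "\<dots> = static_value A S c'" using static_value_optimal[OF y] by simp
  finally show "static_value A S c \<le> static_value A S c'" .
qed

lemma concave_on_static_value: "concave_on {0..} (static_value A S)"
  unfolding concave_on_iff
proof (intro conjI ballI allI impI)
  fix c c' u v :: real assume uv: "u \<ge> 0" "v \<ge> 0" "u + v = 1"
  obtain y where y: "optimal A S (u *\<^sub>R c + v *\<^sub>R c') y" using optimal_exists by blast
  then have yP: "y \<in> prob_simplex" by (simp add: optimal_def)
  have "u * static_value A S c + v * static_value A S c' \<le>
      u * guarantee A S c y + v * guarantee A S c' y"
    using uv static_value_le[OF yP] by (intro add_mono mult_left_mono)
  also have "\<dots> = (u + v) * row_max A y + (u * c + v * c') * (y \<bullet> (S *v y))"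
    by (simp add: guarantee_def algebra_simps)
  also have "\<dots> = guarantee A S (u *\<^sub>R c + v *\<^sub>R c') y" by (simp add: guarantee_def uv)
  also have "\<dots> = static_value A S (u *\<^sub>R c + v *\<^sub>R c')" using static_value_optimal[OF y] by simp
  finally show "u * static_value A S c + v * static_value A S c' \<le> static_value A S (u *\<^sub>R c + v *\<^sub>R c')" .
qed simp

text \<open>Concavity alone would give continuity only in the interior of the half-line. The slopes
  \<open>y \<bullet> (S *v y)\<close> are bounded on the simplex, and such a bound is a Lipschitz constant.\<close>

lemma continuous_on_static_value: "continuous_on X (static_value A S)"
proof -
  have "continuous_on prob_simplex (\<lambda>y. y \<bullet> (S *v y))"
    by (intro continuous_intros bounded_linear.continuous_on[OF matrix_vector_mul_bounded_linear])
  then have "bounded ((\<lambda>y. y \<bullet> (S *v y)) ` prob_simplex)"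
    using compact_prob_simplex compact_continuous_image compact_imp_bounded by blast
  then obtain b where b: "\<And>y. y \<in> prob_simplex \<Longrightarrow> \<bar>y \<bullet> (S *v y)\<bar> \<le> b" and b0: "b > 0"
    by (auto simp: bounded_pos)
  have "static_value A S c' - static_value A S c \<le> b * \<bar>c' - c\<bar>" for c c'
  proof -
    obtain y where y: "optimal A S c y" using optimal_exists by blast
    then have yP: "y \<in> prob_simplex" by (simp add: optimal_def)
    have "static_value A S c' - static_value A S c \<le> guarantee A S c' y - guarantee A S c y"
      using static_value_le[OF yP] static_value_optimal[OF y] by (simp add: diff_mono)
    also have "\<dots> = (c' - c) * (y \<bullet> (S *v y))" by (simp add: guarantee_def algebra_simps)
    also have "\<dots> \<le> \<bar>c' - c\<bar> * \<bar>y \<bullet> (S *v y)\<bar>" by (metis abs_ge_self abs_mult)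
    also have "\<dots> \<le> \<bar>c' - c\<bar> * b" using b[OF yP] by (intro mult_left_mono) auto
    finally show ?thesis by (simp add: mult.commute)
  qed
  note lip = this
  have "b-lipschitz_on X (static_value A S)"
  proof (rule lipschitz_onI)
    show "dist (static_value A S c) (static_value A S c') \<le> b * dist c c'" for c c'
      using lip[of c c'] lip[of c' c] by (simp add: dist_real_def abs_minus_commute abs_le_iff)
  qed (use b0 in simp)
  then show ?thesis by (rule lipschitz_on_continuous_on)
qed

section \<open>Rational branches of the static value\<close>

lemma linear_term_zero_if_local_min:
  fixes s r :: real
  assumes "eventually (\<lambda>e. 0 \<le> e * s + e\<^sup>2 * r) (nhds 0)"
  shows "s = 0"
proof -
  obtain d where d: "d > 0" "\<And>e. \<bar>e\<bar> < d \<Longrightarrow> 0 \<le> e * s + e\<^sup>2 * r"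
    using assms by (auto simp: eventually_nhds_metric dist_real_def)
  have "((\<lambda>e. e * s + e\<^sup>2 * r) has_real_derivative s) (at 0)"
    by (auto intro!: derivative_eq_intros)
  from DERIV_local_min[OF this d(1)] show ?thesis using d(2) by simp
qed

text \<open>The hypotheses on \<open>d\<close> say that it points along the relatively open face of the problem that
  contains \<open>y\<close>: zero coordinates stay zero, the total mass is kept, and all best rows change at the
  same rate \<open>a\<close>. Therefore small steps in both directions \<open>d\<close> and \<open>-d\<close> stay in the simplex, and
  along them \<open>row_max A\<close> is linear with slope \<open>a\<close> although it is not differentiable in general.
  So the derivative of the guarantee vanishes.\<close>

lemma optimal_first_order:
  fixes A :: "real ^ 'n ^ 'm"
  assumes opt: "optimal A S c y"
    and supp: "\<And>j. y $ j = 0 \<Longrightarrow> d $ j = 0" and sum0: "(\<Sum>j\<in>UNIV. d $ j) = 0"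
    and rows: "\<And>i. i \<in> best_rows A y \<Longrightarrow> (A *v d) $ i = a"
  shows "a + c * (y \<bullet> (S *v d) + d \<bullet> (S *v y)) = 0"
proof -
  have yP: "y \<in> prob_simplex" using opt by (simp add: optimal_def)
  have "\<forall>\<^sub>F e in nhds 0. 0 \<le> y $ j + e * d $ j" for j
  proof (cases "y $ j = 0")
    case True
    then show ?thesis using supp by simp
  next
    case False
    then have "0 < y $ j" using yP by (auto simp: prob_simplex_def less_le)
    moreover have "((\<lambda>e. y $ j + e * d $ j) \<longlongrightarrow> y $ j + 0 * d $ j) (nhds 0)"
      by (intro tendsto_intros filterlim_ident)
    ultimately have "\<forall>\<^sub>F e in nhds 0. 0 < y $ j + e * d $ j" 
      by (intro order_tendstoD(1)) auto
    then show ?thesis by eventually_elim simp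
  qed
  then have pos: "\<forall>\<^sub>F e in nhds 0. \<forall>j. 0 \<le> y $ j + e * d $ j" by (rule eventually_all_finite)
  have "\<forall>\<^sub>F e in nhds 0. (A *v y) $ i + e * (A *v d) $ i \<le> row_max A y + e * a" for i
  proof (cases "i \<in> best_rows A y")
    case True
    then show ?thesis using rows by (simp add: best_rows_def)
  next
    case False
    then have "0 < row_max A y - (A *v y) $ i"
      using row_le_row_max[of A y i] by (auto simp: best_rows_def)
    moreover have "((\<lambda>e. row_max A y + e * a - ((A *v y) $ i + e * (A *v d) $ i)) \<longlongrightarrow>
        row_max A y + 0 * a - ((A *v y) $ i + 0 * (A *v d) $ i)) (nhds 0)"
      by (intro tendsto_intros filterlim_ident)
    ultimately have "\<forall>\<^sub>F e in nhds 0. 0 < row_max A y + e * a - ((A *v y) $ i + e * (A *v d) $ i)"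
      by (intro order_tendstoD(1)) auto
    then show ?thesis by eventually_elim simp
  qed
  then have below: "\<forall>\<^sub>F e in nhds 0. \<forall>i. (A *v y) $ i + e * (A *v d) $ i \<le> row_max A y + e * a"
    by (rule eventually_all_finite)
  obtain k where k: "k \<in> best_rows A y" using best_rows_nonempty by blast
  have "\<forall>\<^sub>F e in nhds 0.
      0 \<le> e * (a + c * (y \<bullet> (S *v d) + d \<bullet> (S *v y))) + e\<^sup>2 * (c * (d \<bullet> (S *v d)))"
    using pos below
  proof eventually_elim
    case (elim e)
    have "y + e *\<^sub>R d \<in> prob_simplex"
      using elim(1) yP sum0
      by (simp add: prob_simplex_def sum.distrib flip: sum_distrib_left)
    then have "guarantee A S c y \<le> guarantee A S c (y + e *\<^sub>R d)"
      using opt by (simp add: optimal_def)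
    moreover have "row_max A (y + e *\<^sub>R d) = row_max A y + e * a"
      using elim(2) k rows[OF k]
      by (intro row_max_eqI[where k = k])
        (auto simp: matrix_vector_right_distrib matrix_vector_mult_scaleR best_rows_def)
    ultimately show ?case
      by (simp add: guarantee_def matrix_vector_right_distrib matrix_vector_mult_scaleR
          inner_add_left inner_add_right algebra_simps power2_eq_square)
  qed
  then show ?thesis by (rule linear_term_zero_if_local_min)
qed

text \<open>A quadratic function changes along a segment by the mean of its derivatives at the two ends;
  here both are zero.\<close>

lemma critical_values_equal:
  fixes S :: "real ^ 'n ^ 'n"
  assumes "a (y - z) = a y - a z"
    and "a (y - z) + c * (y \<bullet> (S *v (y - z)) + (y - z) \<bullet> (S *v y)) = 0"
    and "a (y - z) + c * (z \<bullet> (S *v (y - z)) + (y - z) \<bullet> (S *v z)) = 0"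
  shows "a y + c * (y \<bullet> (S *v y)) = a z + c * (z \<bullet> (S *v z))"
  using assms
  by (simp add: matrix_vector_mult_diff_distrib inner_diff_left inner_diff_right algebra_simps)

text \<open>All parameters in \<open>C\<close> have minimizers on the same face. Interpolating two of these minimizers
  affinely in \<open>1/c\<close> yields a critical point for every \<open>c\<close>. It may leave the simplex, but it has the
  same value as the minimizer \<open>Y c\<close>, and that value times \<open>c\<close> is a quadratic polynomial in \<open>c\<close>.\<close>

lemma static_value_rational_on_face:
  fixes A :: "real ^ 'n ^ 'm" and C :: "real set"
  assumes pos: "\<And>c. c \<in> C \<Longrightarrow> c > 0" and opt: "\<And>c. c \<in> C \<Longrightarrow> optimal A S c (Y c)"
    and zeros: "\<And>c. c \<in> C \<Longrightarrow> {j. Y c $ j = 0} = Z"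
    and rows: "\<And>c. c \<in> C \<Longrightarrow> best_rows A (Y c) = I"
  shows "\<exists>p. \<forall>c\<in>C. c * static_value A S c = poly p c"
proof (cases "\<exists>c1\<in>C. \<exists>c2\<in>C. c1 \<noteq> c2")
  case False
  then obtain b where "C \<subseteq> {b}" by blast
  then show ?thesis by (intro exI[of _ "[:b * static_value A S b:]"]) auto
next
  case True
  then obtain c1 c2 where c12: "c1 \<in> C" "c2 \<in> C" "c1 \<noteq> c2" by blast
  have nz: "c1 > 0" "c2 > 0" using pos c12 by auto
  obtain k where k: "k \<in> I" using best_rows_nonempty[of A "Y c1"] rows[OF c12(1)] by blast
  define a where "a = (\<lambda>y. (A *v y) $ k)"
  \<comment> \<open>The line \<open>s \<mapsto> u + s w\<close> passes through \<open>Y c1\<close> at \<open>s = 1/c1\<close> and through \<open>Y c2\<close> at \<open>s = 1/c2\<close>.\<close>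
  define r where "r = 1 / (1 / c2 - 1 / c1)"
  define w where "w = r *\<^sub>R (Y c2 - Y c1)"
  define u where "u = Y c1 - (1 / c1) *\<^sub>R w"
  have diff: "1 / c2 - 1 / c1 \<noteq> 0" using c12(3) nz by (simp add: field_simps)
  have "(1 / c2 - 1 / c1) *\<^sub>R w = Y c2 - Y c1" using diff by (simp add: w_def r_def)
  then have Y2: "Y c2 = u + (1 / c2) *\<^sub>R w" 
    by (simp add: u_def algebra_simps)
  have Y1: "Y c1 = u + (1 / c1) *\<^sub>R w" by (simp add: u_def)
  have lin: "a (x + y) = a x + a y" "a (x - y) = a x - a y" "a (s *\<^sub>R x) = s * a x" for x y s
    by (simp_all add: a_def matrix_vector_right_distrib matrix_vector_mult_diff_distrib
        matrix_vector_mult_scaleR)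
  have val: "static_value A S c = a (Y c) + c * (Y c \<bullet> (S *v Y c))" if "c \<in> C" for c
    using static_value_optimal[OF opt[OF that]] rows[OF that] k
    by (auto simp: guarantee_def best_rows_def a_def)
  let ?p = "[:a w + w \<bullet> (S *v w), a u + u \<bullet> (S *v w) + w \<bullet> (S *v u), u \<bullet> (S *v u):]"
  have "c * static_value A S c = poly ?p c" if c: "c \<in> C" for c
  proof -
    define z where "z = u + (1 / c) *\<^sub>R w"
    define d where "d = Y c - z"
    have c0: "c > 0" using pos c .
    have z_eq: "z = Y c1 + (1 / c - 1 / c1) *\<^sub>R w" by (simp add: z_def u_def algebra_simps)
    \<comment> \<open>As a combination of differences of minimizers, \<open>d\<close> is a direction along the common face.\<close>
    have d_eq: "d = (Y c - Y c1) - ((1 / c - 1 / c1) * r) *\<^sub>R (Y c2 - Y c1)"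
      by (simp add: d_def z_eq w_def)
    have crit: "a d + c' * (Y c' \<bullet> (S *v d) + d \<bullet> (S *v Y c')) = 0" if c': "c' \<in> C" for c'
    proof (rule optimal_first_order[OF opt[OF c']])
      show "d $ j = 0" if "Y c' $ j = 0" for j
      proof -
        have "j \<in> Z" using that zeros[OF c'] by blast
        then have "Y c $ j = 0" "Y c1 $ j = 0" "Y c2 $ j = 0"
          using zeros[OF c] zeros[OF c12(1)] zeros[OF c12(2)] by blast+
        then show ?thesis by (simp add: d_eq)
      qed
      have "(\<Sum>j\<in>UNIV. Y x $ j) = 1" if "x \<in> C" for x
        using opt[OF that] by (simp add: optimal_def prob_simplex_def)
      then show "(\<Sum>j\<in>UNIV. d $ j) = 0"
        using c c12 by (simp add: d_eq sum_subtractf flip: sum_distrib_left)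
      show "(A *v d) $ i = a d" if "i \<in> best_rows A (Y c')" for i
      proof -
        have "i \<in> I" using that rows[OF c'] by simp
        then have "(A *v Y x) $ i = a (Y x)" if "x \<in> C" for x
          using rows[OF that] k by (auto simp: best_rows_def a_def)
        then show ?thesis
          using c c12 by (simp add: d_eq lin matrix_vector_mult_diff_distrib
              matrix_vector_mult_scaleR)
      qed
    qed
    define \<beta> where "\<beta> = (\<lambda>y. y \<bullet> (S *v d) + d \<bullet> (S *v y))"
    have \<beta>: "\<beta> (x + s *\<^sub>R y) = \<beta> x + s * \<beta> y" for x y s
      by (simp add: \<beta>_def matrix_vector_right_distrib matrix_vector_mult_scaleR
          inner_add_left inner_add_right algebra_simps)
    have e: "a d * (1 / c') + \<beta> u + (1 / c') * \<beta> w = 0"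
      if "c' \<in> C" "Y c' = u + (1 / c') *\<^sub>R w" for c'
    proof -
      have "c' > 0" using pos that(1) .
      have "a d + c' * (\<beta> u + (1 / c') * \<beta> w) = 0"
        using crit[OF that(1)] \<beta>[of u "1 / c'" w] that(2) by (simp add: \<beta>_def)
      then have "c' * (a d * (1 / c') + \<beta> u + (1 / c') * \<beta> w) = 0"
        using \<open>c' > 0\<close> by (simp add: distrib_left)
      then show ?thesis using \<open>c' > 0\<close> by simp
    qed
    \<comment> \<open>The condition is affine in \<open>1/c\<close> along the line and holds at two parameters, so both of its
       coefficients are zero and it holds at \<open>c\<close> as well.\<close>
    have "(1 / c2 - 1 / c1) * (a d + \<beta> w) = 0"
      using e[OF c12(1) Y1] e[OF c12(2) Y2] by (simp add: algebra_simps)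
    then have aw: "a d + \<beta> w = 0" using diff by simp
    have "(1 / c1) * (a d + \<beta> w) + \<beta> u = 0"
      using e[OF c12(1) Y1] by (simp add: algebra_simps)
    then have "\<beta> u = 0" using aw by simp
    then have "a d + c * \<beta> z = 0" using aw c0 by (simp add: z_def \<beta>)
    then have "static_value A S c = a z + c * (z \<bullet> (S *v z))"
      unfolding val[OF c] using crit[OF c]
      by (intro critical_values_equal) (auto simp: d_def \<beta>_def lin)
    then have "c * static_value A S c = a (c *\<^sub>R z) + (c *\<^sub>R z) \<bullet> (S *v (c *\<^sub>R z))"
      by (simp add: lin matrix_vector_mult_scaleR algebra_simps)
    also have "c *\<^sub>R z = c *\<^sub>R u + w" using c0 by (simp add: z_def scaleR_add_right)
    finally show ?thesis
      by (simp add: lin matrix_vector_right_distrib matrix_vector_mult_scaleR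
          inner_add_left inner_add_right algebra_simps)
  qed
  then show ?thesis by blast
qed

lemma static_value_rational_branches:
  fixes A :: "real ^ 'n ^ 'm"
  shows "\<exists>P. finite P \<and> (\<forall>c>0. \<exists>p\<in>P. c * static_value A S c = poly p c)"
proof -
  obtain Y where Y: "\<And>c. optimal A S c (Y c)" using optimal_exists by metis
  define face where "face = (\<lambda>c. ({j. Y c $ j = 0}, best_rows A (Y c)))"
  have "\<exists>p. \<forall>c\<in>{c. c > 0 \<and> face c = t}. c * static_value A S c = poly p c" for t
    by (rule static_value_rational_on_face[where Y = Y and Z = "fst t" and I = "snd t"])
      (auto simp: face_def Y)
  then have "\<forall>t. \<exists>p. \<forall>c\<in>{c. c > 0 \<and> face c = t}. c * static_value A S c = poly p c" by blast
  then obtain p where "\<forall>t. \<forall>c\<in>{c. c > 0 \<and> face c = t}. c * static_value A S c = poly (p t) c"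
    unfolding choice_iff by blast
  then have "c * static_value A S c = poly (p (face c)) c" if "c > 0" for c using that by blast
  moreover have "finite (range p)" by simp
  ultimately show ?thesis by blast
qed

text \<open>The graph lies on the curves \<open>c w = p(c)\<close>, whence the common denominator \<open>[:0, 1:]\<close>. It
  vanishes at \<open>c = 0\<close>, where the graph contributes a single point and no branch is required.\<close>

theorem proposition2:
  fixes A :: "real ^ 'n ^ 'm" and S :: "real ^ 'n ^ 'n"
  assumes "switching_cost_matrix S"
  shows "continuous_on {0..} (static_value A S) \<and>
         mono_on {0..} (static_value A S) \<and>
         concave_on {0..} (static_value A S) \<and>
         semialgebraic_on {0..} (static_value A S)"
proof (intro conjI continuous_on_static_value mono_on_static_value concave_on_static_value assms)
  obtain P where P: "finite P" "\<And>c. c > 0 \<Longrightarrow> \<exists>p\<in>P. c * static_value A S c = poly p c"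
    using static_value_rational_branches[of A S] by blast
  show "semialgebraic_on {0..} (static_value A S)"
    by (rule semialgebraic_on_if_rational_branches[where R = "(\<lambda>p. (p, [:0, 1:])) ` P"])
      (use P in \<open>auto simp: continuous_on_static_value\<close>)
qed

end
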